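(* If $n$ is odd, $$I_n(f_1)=\frac{2|\Phi|}{\pi\sqrt{|d|}}\,n^2\log n.$$ If $n$ is even, as $n\to\infty$, $$I_n(f_1)=\frac{2|\Phi|}{\pi\sqrt{|d|}}\,n^2\log n-\Big(\frac{|\Phi|}{\pi\sqrt{|d|}}+\frac{2|\Phi|}{\pi^2}\frac1{a-b+c}\Big)+\mathcal O\Big(\frac1{n^2}\Big).$$
   Context: Let $\Phi=\{\mathbf b_1,\dots,\mathbf b_{|\Phi|}\}$ be a finite collection of nonzero vectors in a two-dimensional real vector space generating a lattice $\Lambda=\mathbb Z\Phi$ of full rank, with $\{\mathbf b_1,\mathbf b_2\}$ a basis of $\Lambda$. Write $\mathbf b_\ell=s_{1,\ell}\mathbf b_1+s_{2,\ell}\mathbf b_2$ and $\mathbf s_\ell=(s_{1,\ell},s_{2,\ell})\in\mathbb Z^2\setminus\{\mathbf 0\}$, so $\mathbf s_1=(1,0)$, $\mathbf s_2=(0,1)$. $\Phi$ is fixed. Put $$a=\sum_{\ell=1}^{|\Phi|}s_{1,\ell}^2,\quad b=2\sum_{\ell=1}^{|\Phi|}s_{1,\ell}s_{2,\ell},\quad c=\sum_{\ell=1}^{|\Phi|}s_{2,\ell}^2,\quad d=b^2-4ac\ (<0).$$ Let $p_1(\mathbf x)=\frac1{2|\Phi|}\sum_{\ell=1}^{|\Phi|}(\mathbf s_\ell\cdot\mathbf x)^2$ and $f_1=1/p_1$, i.e. $f_1(x,y)=\frac{2|\Phi|}{ax^2+bxy+cy^2}$. For a positive integer $n$ let $\Delta_n=2\pi/n$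 and $$D_n=\begin{cases}[-\pi,\pi]^2\setminus[-\frac\pi n,\frac\pi n]^2,& n\text{ odd},\\ [-\pi-\frac\pi n,\pi-\frac\pi n]^2\setminus[-\frac\pi n,\frac\pi n]^2,& n\text{ even},\end{cases}\qquad I_n(f_1)=\frac1{\Delta_n^2}\iint_{D_n}f_1(\mathbf x)\,d\mathbf x.$$ *)

theory Defs
  imports "HOL-Analysis.Analysis" "HOL-Library.Landau_Symbols"
begin

definition int_scale :: "int \<Rightarrow> 'v::real_vector \<Rightarrow> 'v"
  where "int_scale k v = real_of_int k *\<^sub>R v"

(* Module notions over the ring of integers; the unqualified span and
   independent below are the real ones. *)
abbreviation int_span :: "'v::real_vector set \<Rightarrow> 'v set"
  where "int_span \<equiv> module.span int_scale"

definition is_int_basis :: "'v::real_vector set \<Rightarrow> 'v set \<Rightarrow> bool"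
  where "is_int_basis B L \<longleftrightarrow> \<not> module.dependent int_scale B \<and> int_span B = L"

definition full_rank_lattice :: "'v::real_vector set \<Rightarrow> bool"
  where "full_rank_lattice L \<longleftrightarrow>
    (\<exists>B. finite B \<and> independent B \<and> span B = UNIV \<and> int_span B = L)"

(* In the following, N is the size of the collection and s l, for l in {1..N}, is the
   vector of integer coordinates of its l-th member. *)

definition coeff_a :: "nat \<Rightarrow> (nat \<Rightarrow> int \<times> int) \<Rightarrow> int"
  where "coeff_a N s = (\<Sum>l=1..N. (fst (s l))\<^sup>2)"

definition coeff_b :: "nat \<Rightarrow> (nat \<Rightarrow> int \<times> int) \<Rightarrow> int"
  where "coeff_b N s = 2 * (\<Sum>l=1..N. fst (s l) * snd (s l))"

definition coeff_c :: "nat \<Rightarrow> (nat \<Rightarrow> int \<times> int) \<Rightarrow> int"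
  where "coeff_c N s = (\<Sum>l=1..N. (snd (s l))\<^sup>2)"

definition discr :: "nat \<Rightarrow> (nat \<Rightarrow> int \<times> int) \<Rightarrow> int"
  where "discr N s = (coeff_b N s)\<^sup>2 - 4 * coeff_a N s * coeff_c N s"

definition p1 :: "nat \<Rightarrow> (nat \<Rightarrow> int \<times> int) \<Rightarrow> real \<times> real \<Rightarrow> real"
  where "p1 N s x = 1 / (2 * real N) *
    (\<Sum>l=1..N. (real_of_int (fst (s l)) * fst x + real_of_int (snd (s l)) * snd x)\<^sup>2)"

definition f1 :: "nat \<Rightarrow> (nat \<Rightarrow> int \<times> int) \<Rightarrow> real \<times> real \<Rightarrow> real"
  where "f1 N s x = 1 / p1 N s x"

definition mesh :: "nat \<Rightarrow> real"
  where "mesh n = 2 * pi / real n"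

definition D :: "nat \<Rightarrow> (real \<times> real) set"
  where "D n =
    (if odd n then {-pi..pi} \<times> {-pi..pi}
     else {-pi - pi / real n..pi - pi / real n} \<times> {-pi - pi / real n..pi - pi / real n})
    - {-pi / real n..pi / real n} \<times> {-pi / real n..pi / real n}"

definition I :: "nat \<Rightarrow> (real \<times> real \<Rightarrow> real) \<Rightarrow> real"
  where "I n f = 1 / (mesh n)\<^sup>2 * (LINT x:D n|lborel. f x)"

end

theory Submission
  imports Defs
begin

text \<open>
  Write \<open>f\<^sub>1 = 2 N / Q\<close> with the positive definite form \<open>Q(x, y) = a x\<^sup>2 + b x y + c y\<^sup>2\<close>, and let \<open>\<nu>\<close> be the
  measure with density \<open>1 / Q\<close>. By homogeneity, the square annulus between the half-widths \<open>r < R\<close>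
  has \<open>\<nu>\<close>-measure \<open>K ln (R / r)\<close>, where \<open>K\<close> is a sum of two arctangent integrals that adds up
  to \<open>4 pi / sqrt (4 a c - b\<^sup>2)\<close>; this settles odd \<open>n\<close>. For even \<open>n\<close>, put \<open>h = pi / n\<close> and
  compare the shifted square with its mirror image at the origin: since \<open>\<nu>\<close> is invariant under
  \<open>z \<mapsto> -z\<close>, its measure is the mean of those of the centred squares of half-width \<open>pi + h\<close> and
  \<open>pi - h\<close>, minus the measure of a corner square of side \<open>2 h\<close> centred at \<open>(pi, -pi)\<close>. The logarithms
  give \<open>2 ln n + ln (1 - 1 / n\<^sup>2)\<close>, and the midpoint rule evaluates the corner up to \<open>O(h\<^sup>4)\<close>.
\<close>

section \<open>An addition formula for the arctangent\<close>

text \<open>For \<open>u = arctan p\<close> and \<open>v = arctan q\<close>, the hypothesis on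
  \<open>k\<close> says that \<open>cos (u + v) / sin (u + v) = - k\<close>, so
  \<open>u + v - pi / 2\<close> has tangent \<open>k\<close>. Positivity of \<open>p + q\<close>
  puts \<open>u + v\<close> in the interval from 0 to \<open>pi\<close>, which selects the principal
  branch. Working with the cotangent also covers \<open>p * q = 1\<close>, where the tangent of the
  sum is undefined.\<close>

lemma arctan_add_eq_pi_half_add_arctan:
  fixes p q k :: real
  assumes pos: "0 < p + q" and k: "p * q - 1 = k * (p + q)"
  shows "arctan p + arctan q = pi / 2 + arctan k"
proof -
  define u v where "u = arctan p" and "v = arctan q"
  have u: "-(pi/2) < u" "u < pi/2" "cos u > 0" "tan u = p"
    and v: "-(pi/2) < v" "v < pi/2" "cos v > 0" "tan v = q"
    using arctan_bounded[of p] arctan_bounded[of q]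
    by (auto simp: u_def v_def cos_gt_zero_pi tan_arctan)
  have s: "sin u = p * cos u" "sin v = q * cos v"
    using u v by (auto simp: tan_def field_simps)
  have sin_eq: "sin (u + v) = cos u * cos v * (p + q)"
    by (simp add: sin_add s algebra_simps)
  have cos_eq: "cos (u + v) = - cos u * cos v * (p * q - 1)"
    by (simp add: cos_add s algebra_simps)
  have sin_pos: "sin (u + v) > 0"
    unfolding sin_eq using u v pos by simp
  have "u + v > 0"
  proof (rule ccontr)
    assume "\<not> u + v > 0"
    then have "sin (-(u + v)) \<ge> 0"
      using u v by (intro sin_ge_zero) auto
    with sin_pos show False by (simp only: sin_minus)
  qed
  moreover have "tan (u + v - pi/2) = k"
  proof -
    have "tan (u + v - pi/2) = - cos (u + v) / sin (u + v)"
      by (simp add: tan_def sin_diff cos_diff)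
    also have "\<dots> = k"
      using sin_pos unfolding k cos_eq sin_eq by (simp add: field_simps)
    finally show ?thesis .
  qed
  ultimately have "arctan k = u + v - pi/2"
    using u v by (intro arctan_unique) auto
  then show ?thesis by (simp add: u_def v_def)
qed

section \<open>Centred squares and the measure with density \<open>1 / Q\<close>\<close>

definition sq :: "real \<Rightarrow> (real \<times> real) set"
  where "sq r = {-r..r} \<times> {-r..r}"

lemma sq_sets [measurable]: "sq r \<in> sets borel"
  unfolding sq_def by (intro borel_closed closed_Times) auto

locale posdef_form =
  fixes a b c :: real
  assumes a_pos: "0 < a" and discr_neg: "b\<^sup>2 < 4 * a * c"
begin

definition Q :: "real \<times> real \<Rightarrow> real"
  where "Q z = a * (fst z)\<^sup>2 + b * fst z * snd z + c * (snd z)\<^sup>2"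

text \<open>As a measure, the integral of \<open>1 / Q\<close> turns dissections of squares into
  additivity, and Tonelli applies before finiteness is known. At the origin \<open>1 / Q\<close> has
  the default value 0.\<close>

definition \<nu> :: "(real \<times> real) measure"
  where "\<nu> = density lborel (\<lambda>z. ennreal (1 / Q z))"

definition \<delta> :: real
  where "\<delta> = 4 * a * c - b\<^sup>2"

lemma delta_pos: "0 < \<delta>"
  using discr_neg by (simp add: \<delta>_def)

lemma c_pos: "0 < c"
proof -
  have "0 < a * c"
    using discr_neg zero_le_power2[of b] by linarith
  with a_pos show ?thesis by (simp add: zero_less_mult_iff)
qed

text \<open>Completing the square in the second coordinate. Besides definiteness, this gives a lower
  bound for \<open>Q\<close> that is uniform on a half-plane away from the origin.\<close>

lemma Q_ge: "\<delta> * (fst z)\<^sup>2 / (4 * c) \<le> Q z"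
proof -
  have "4 * c * Q z = (2 * c * snd z + b * fst z)\<^sup>2 + \<delta> * (fst z)\<^sup>2"
    unfolding Q_def \<delta>_def by algebra
  then have "\<delta> * (fst z)\<^sup>2 \<le> 4 * c * Q z" by simp
  then show ?thesis using c_pos by (simp add: field_simps)
qed

lemma Q_pos:
  assumes "z \<noteq> 0"
  shows "0 < Q z"
proof (cases "fst z = 0")
  case True
  with assms have "snd z \<noteq> 0" by (simp add: prod_eq_iff)
  with True c_pos show ?thesis by (simp add: Q_def)
next
  case False
  then have "0 < \<delta> * (fst z)\<^sup>2 / (4 * c)"
    using delta_pos c_pos by simp
  then show ?thesis using Q_ge[of z] by linarith
qed

lemma Q_zero [simp]: "Q 0 = 0"
  by (simp add: Q_def)

lemma Q_nonneg: "0 \<le> Q z"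
  using Q_pos[of z] by (cases "z = 0") auto

lemma Q_uminus [simp]: "Q (- z) = Q z"
  by (simp add: Q_def)

lemma Q_scale: "Q (x, x * t) = x\<^sup>2 * Q (1, t)"
  by (simp add: Q_def power2_eq_square algebra_simps)

lemma continuous_on_Q [continuous_intros]: "continuous_on S Q"
  unfolding Q_def by (intro continuous_intros)

lemma measurable_Q [measurable]: "Q \<in> borel_measurable borel"
  by (intro borel_measurable_continuous_onI continuous_on_Q)

lemma sets_nu [simp]: "sets \<nu> = sets borel"
  by (simp add: \<nu>_def)

lemma emeasure_nu: "S \<in> sets borel \<Longrightarrow> emeasure \<nu> S = (\<integral>\<^sup>+z. ennreal (1 / Q z) * indicator S z \<partial>lborel)"
  unfolding \<nu>_def by (subst emeasure_density) auto

text \<open>If the mass is infinite, both sides take the default value 0.\<close>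

lemma measure_nu: "S \<in> sets borel \<Longrightarrow> measure \<nu> S = (LINT z:S|lborel. 1 / Q z)"
  unfolding set_lebesgue_integral_def measure_def
  by (subst integral_eq_nn_integral)
     (auto simp: emeasure_nu Q_nonneg indicator_def intro!: arg_cong[where f = enn2real] nn_integral_cong)

lemma emeasure_nu_uminus:
  assumes [measurable]: "S \<in> sets borel"
  shows "emeasure \<nu> (uminus ` S) = emeasure \<nu> S"
proof -
  have img: "uminus ` S = uminus -` S"
    by (force simp: image_iff)
  have [measurable]: "uminus ` S \<in> sets borel"
    unfolding img by (rule measurable_sets_borel[OF _ assms]) simp
  have "emeasure \<nu> (uminus ` S) = (\<integral>\<^sup>+z. ennreal (1 / Q (-z)) * indicator (uminus ` S) (-z) \<partial>lborel)"
    by (subst emeasure_nu, simp, subst lborel_affine[of "-1" 0])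
       (simp_all add: nn_integral_density nn_integral_distr)
  also have "\<dots> = emeasure \<nu> S"
    by (simp add: emeasure_nu img indicator_def)
  finally show ?thesis .
qed

section \<open>The measure of a square annulus\<close>

lemma nn_integral_inverse_abs:
  fixes r R :: real
  assumes "0 < r" "r \<le> R"
  shows "(\<integral>\<^sup>+x. ennreal (1 / \<bar>x\<bar>) * indicator {x. r < \<bar>x\<bar> \<and> \<bar>x\<bar> \<le> R} x \<partial>lborel) = ennreal (2 * ln (R / r))"
proof -
  have "((\<lambda>x. 1 / x) has_integral (ln R - ln r)) {r..R}"
    using assms by (intro fundamental_theorem_of_calculus)
      (auto intro!: derivative_eq_intros simp flip: has_real_derivative_iff_has_vector_derivative)
  then have pos: "((\<lambda>x. 1 / \<bar>x\<bar>) has_integral (ln R - ln r)) {r..R}"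
    using assms by (subst has_integral_cong[where g = "\<lambda>x. 1 / x"]) auto
  then have "((\<lambda>x. 1 / \<bar>x\<bar>) has_integral (ln R - ln r)) {-R..-r}"
    using has_integral_reflect_real[of "\<lambda>x. 1 / \<bar>x\<bar>" "ln R - ln r" R r] by simp
  moreover have "negligible ({-R..-r} \<inter> {r..R})"
    using assms by (intro negligible_subset[OF negligible_empty]) auto
  ultimately have "((\<lambda>x. 1 / \<bar>x\<bar>) has_integral ((ln R - ln r) + (ln R - ln r))) ({-R..-r} \<union> {r..R})"
    using pos by (intro has_integral_Un)
  moreover have "(ln R - ln r) + (ln R - ln r) = 2 * ln (R / r)"
    using assms by (simp add: ln_div)
  ultimately have "((\<lambda>x. 1 / \<bar>x\<bar>) has_integral (2 * ln (R / r))) ({-R..-r} \<union> {r..R})"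
    by simp
  \<comment> \<open>Strictness at \<open>r\<close> matches the removal of a closed square; only the
    points \<open>-r\<close> and \<open>r\<close> change.\<close>
  then have "((\<lambda>x. 1 / \<bar>x\<bar>) has_integral (2 * ln (R / r))) {x. r < \<bar>x\<bar> \<and> \<bar>x\<bar> \<le> R}"
  proof (rule has_integral_spike_set_eq[THEN iffD1, rotated 2])
    show "negligible {x \<in> {-R..-r} \<union> {r..R} - {x. r < \<bar>x\<bar> \<and> \<bar>x\<bar> \<le> R}. 1 / \<bar>x\<bar> \<noteq> 0}"
      by (rule negligible_subset[of "{-r, r}"]) (use assms in auto)
    show "negligible {x \<in> {x. r < \<bar>x\<bar> \<and> \<bar>x\<bar> \<le> R} - ({-R..-r} \<union> {r..R}). 1 / \<bar>x\<bar> \<noteq> 0}"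
      by (rule negligible_subset[of "{}"]) (use assms in auto)
  qed
  then show ?thesis
    by (rule nn_integral_has_integral_lebesgue'[rotated]) auto
qed

text \<open>Substituting \<open>y = x t\<close> in the inner integral separates the variables, because \<open>Q\<close> is
  homogeneous of degree 2.\<close>

lemma nn_integral_sector:
  fixes r R :: real and T :: "real set"
  assumes [measurable]: "T \<in> sets borel" and "0 < r" "r \<le> R"
  shows "(\<integral>\<^sup>+x. \<integral>\<^sup>+y. ennreal (1 / Q (x, y)) * indicator {x. r < \<bar>x\<bar> \<and> \<bar>x\<bar> \<le> R} x * indicator T (y / x) \<partial>lborel \<partial>lborel)
    = ennreal (2 * ln (R / r)) * (\<integral>\<^sup>+t. ennreal (1 / Q (1, t)) * indicator T t \<partial>lborel)"
    (is "(\<integral>\<^sup>+x. ?in x \<partial>lborel) = _ * ?J")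
proof -
  have inner: "?in x = ennreal (1 / \<bar>x\<bar>) * indicator {x. r < \<bar>x\<bar> \<and> \<bar>x\<bar> \<le> R} x * ?J" for x
  proof (cases "r < \<bar>x\<bar> \<and> \<bar>x\<bar> \<le> R")
    case True
    with assms have x: "x \<noteq> 0" by auto
    have "?in x = ennreal \<bar>x\<bar> * (\<integral>\<^sup>+t. ennreal (1 / Q (x, x * t)) * indicator T t \<partial>lborel)"
      using x True by (subst nn_integral_real_affine[OF _ x, of _ 0]) auto
    also have "\<dots> = (\<integral>\<^sup>+t. ennreal \<bar>x\<bar> * (ennreal (1 / Q (x, x * t)) * indicator T t) \<partial>lborel)"
      by (rule nn_integral_cmult[symmetric]) measurable
    also have "\<dots> = (\<integral>\<^sup>+t. ennreal (1 / \<bar>x\<bar>) * (ennreal (1 / Q (1, t)) * indicator T t) \<partial>lborel)"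
    proof (intro nn_integral_cong)
      fix t
      \<comment> \<open>The Jacobian \<open>\<bar>x\<bar>\<close> against the factor
        \<open>x\<^sup>2\<close> from homogeneity leaves \<open>1 / \<bar>x\<bar>\<close>.\<close>
      have "\<bar>x\<bar> * (1 / Q (x, x * t)) = 1 / \<bar>x\<bar> * (1 / Q (1, t))"
        using x by (cases "0 < x") (simp_all add: Q_scale power2_eq_square)
      then show "ennreal \<bar>x\<bar> * (ennreal (1 / Q (x, x * t)) * indicator T t)
        = ennreal (1 / \<bar>x\<bar>) * (ennreal (1 / Q (1, t)) * indicator T t)"
        by (simp only: mult.assoc[symmetric] ennreal_mult[symmetric] Q_nonneg abs_ge_zero
            divide_nonneg_nonneg zero_le_one)
    qed
    also have "\<dots> = ennreal (1 / \<bar>x\<bar>) * ?J"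
      by (rule nn_integral_cmult) measurable
    finally show ?thesis using True by simp
  qed auto
  show ?thesis
    unfolding inner using assms
    by (subst nn_integral_multc) (simp_all add: nn_integral_inverse_abs)
qed

text \<open>Completing the square,
  \<open>4 * c * Q (1, t) = \<delta> + (2 * c * t + b)\<^sup>2\<close>, exhibits the integrand as
  the derivative of a scaled arctangent.\<close>

lemma has_integral_edge:
  "((\<lambda>t. 1 / Q (1, t)) has_integral
     2 / sqrt \<delta> * (arctan ((2 * c + b) / sqrt \<delta>) + arctan ((2 * c - b) / sqrt \<delta>))) {-1..1}"
proof -
  let ?F = "\<lambda>t. 2 / sqrt \<delta> * arctan ((2 * c * t + b) / sqrt \<delta>)"
  have D: "(?F has_real_derivative 1 / Q (1, t)) (at t within {-1..1})" for t
  proof -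
    have s: "sqrt \<delta> > 0" "sqrt \<delta> * sqrt \<delta> = \<delta>" using delta_pos by auto
    have eq: "4 * c * Q (1, t) = \<delta> + (2 * c * t + b)\<^sup>2"
      unfolding Q_def \<delta>_def by (simp add: power2_eq_square algebra_simps)
    have Qp: "Q (1, t) > 0" by (intro Q_pos) (simp add: prod_eq_iff)
    have "1 + ((2 * c * t + b) / sqrt \<delta>)\<^sup>2 = 4 * c * Q (1, t) / \<delta>"
      unfolding eq using s delta_pos by (simp add: power_divide field_simps)
    then have slope: "2 / sqrt \<delta> * (inverse (1 + ((2 * c * t + b) / sqrt \<delta>)\<^sup>2) * (2 * c / sqrt \<delta>)) = 1 / Q (1, t)"
      using s delta_pos c_pos Qp by (simp add: field_simps)
    have deriv: "((\<lambda>t. 2 / k * arctan ((2 * c * t + b) / k)) has_real_derivative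
        2 / k * (inverse (1 + ((2 * c * t + b) / k)\<^sup>2) * (2 * c / k))) (at t within {-1..1})"
      if "0 < k" for k
      using that by (auto intro!: derivative_eq_intros)
    show ?thesis
      using deriv[OF s(1)] unfolding slope .
  qed
  have "((\<lambda>t. 1 / Q (1, t)) has_integral ?F 1 - ?F (-1)) {-1..1}"
    using D by (intro fundamental_theorem_of_calculus)
      (auto simp flip: has_real_derivative_iff_has_vector_derivative)
  moreover have "arctan ((b - 2 * c) / sqrt \<delta>) = - arctan ((2 * c - b) / sqrt \<delta>)"
    by (simp flip: arctan_minus add: minus_divide_left)
  ultimately show ?thesis by (simp add: algebra_simps)
qed

text \<open>Exchanging the coordinates carries the sectors around the vertical axis to those around
  the horizontal one, so the sector and edge lemmas serve for both.\<close>

lemma swap: "posdef_form c b a"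
  using c_pos discr_neg by unfold_locales (simp_all add: mult_ac)

lemma Q_swap: "posdef_form.Q c b a (y, x) = Q (x, y)"
  by (simp add: Q_def posdef_form.Q_def[OF swap])

lemma delta_swap: "posdef_form.\<delta> c b a = \<delta>"
  by (simp add: \<delta>_def posdef_form.\<delta>_def[OF swap])

text \<open>Terms with the same sign of \<open>b\<close> are paired, and the two pairs give
  \<open>pi / 2\<close> plus and minus \<open>arctan (b / sqrt \<delta>)\<close>. The positivity
  required of each pair is that of \<open>Q\<close> at the corners \<open>(1, 1)\<close> and
  \<open>(1, -1)\<close>.\<close>

lemma edge_sum:
  "arctan ((2 * c + b) / sqrt \<delta>) + arctan ((2 * c - b) / sqrt \<delta>)
    + (arctan ((2 * a + b) / sqrt \<delta>) + arctan ((2 * a - b) / sqrt \<delta>)) = pi"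
proof -
  have s: "sqrt \<delta> > 0" "sqrt \<delta> * sqrt \<delta> = \<delta>" using delta_pos by auto
  have "0 < a + b + c" "0 < a - b + c"
    using Q_pos[of "(1, 1)"] Q_pos[of "(1, -1)"] by (auto simp: Q_def zero_prod_def)
  have "arctan ((2 * c + b) / sqrt \<delta>) + arctan ((2 * a + b) / sqrt \<delta>) = pi / 2 + arctan (b / sqrt \<delta>)"
  proof (rule arctan_add_eq_pi_half_add_arctan)
    show "0 < (2 * c + b) / sqrt \<delta> + (2 * a + b) / sqrt \<delta>"
      using s \<open>0 < a + b + c\<close> by (simp flip: add_divide_distrib)
    show "(2 * c + b) / sqrt \<delta> * ((2 * a + b) / sqrt \<delta>) - 1
      = b / sqrt \<delta> * ((2 * c + b) / sqrt \<delta> + (2 * a + b) / sqrt \<delta>)"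
      using s delta_pos
      by (simp add: field_simps) (simp add: \<delta>_def power2_eq_square algebra_simps)
  qed
  moreover have "arctan ((2 * c - b) / sqrt \<delta>) + arctan ((2 * a - b) / sqrt \<delta>) = pi / 2 + arctan (- b / sqrt \<delta>)"
  proof (rule arctan_add_eq_pi_half_add_arctan)
    show "0 < (2 * c - b) / sqrt \<delta> + (2 * a - b) / sqrt \<delta>"
      using s \<open>0 < a - b + c\<close> by (simp flip: add_divide_distrib)
    show "(2 * c - b) / sqrt \<delta> * ((2 * a - b) / sqrt \<delta>) - 1
      = - b / sqrt \<delta> * ((2 * c - b) / sqrt \<delta> + (2 * a - b) / sqrt \<delta>)"
      using s delta_pos
      by (simp add: field_simps) (simp add: \<delta>_def power2_eq_square algebra_simps)
  qed
  ultimately show ?thesis by (simp add: arctan_minus)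
qed

text \<open>The diagonals cut the annulus into two double sectors, \<open>?A\<close> and
  \<open>?B\<close>. The slope range is closed in one and open in the other, so that the diagonals
  are counted exactly once.\<close>

lemma emeasure_sq_diff:
  assumes "0 < r" "r \<le> R"
  shows "emeasure \<nu> (sq R - sq r) = ennreal (4 * pi / sqrt \<delta> * ln (R / r))"
proof -
  interpret sw: posdef_form c b a by (rule swap)
  let ?c = "ennreal (2 * ln (R / r))"
  let ?A = "\<lambda>x y. ennreal (1 / Q (x, y)) * indicator {x. r < \<bar>x\<bar> \<and> \<bar>x\<bar> \<le> R} x * indicator {-1..1} (y / x)"
  let ?B = "\<lambda>x y. ennreal (1 / sw.Q (y, x)) * indicator {x. r < \<bar>x\<bar> \<and> \<bar>x\<bar> \<le> R} y * indicator {-1<..<1} (x / y)"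
  have split: "ennreal (1 / Q (x, y)) * indicator (sq R - sq r) (x, y) = ?A x y + ?B x y" for x y
  proof -
    have div: "u / v \<in> {-1..1} \<longleftrightarrow> \<bar>u\<bar> \<le> \<bar>v\<bar>" "u / v \<in> {-1<..<1} \<longleftrightarrow> \<bar>u\<bar> < \<bar>v\<bar>"
      if "v \<noteq> 0" for u v :: real
    proof -
      have "u / v \<in> {-1..1} \<longleftrightarrow> \<bar>u / v\<bar> \<le> 1" "u / v \<in> {-1<..<1} \<longleftrightarrow> \<bar>u / v\<bar> < 1"
        by (simp_all only: abs_le_iff abs_less_iff atLeastAtMost_iff greaterThanLessThan_iff) linarith+
      with that show "u / v \<in> {-1..1} \<longleftrightarrow> \<bar>u\<bar> \<le> \<bar>v\<bar>" "u / v \<in> {-1<..<1} \<longleftrightarrow> \<bar>u\<bar> < \<bar>v\<bar>"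
        by (simp_all add: abs_divide)
    qed
    have "(x, y) \<in> sq R - sq r \<longleftrightarrow>
        (r < \<bar>x\<bar> \<and> \<bar>x\<bar> \<le> R \<and> \<bar>y\<bar> \<le> \<bar>x\<bar>) \<or> (r < \<bar>y\<bar> \<and> \<bar>y\<bar> \<le> R \<and> \<bar>x\<bar> < \<bar>y\<bar>)"
      unfolding sq_def by auto
    moreover have "\<not> (\<bar>y\<bar> \<le> \<bar>x\<bar> \<and> \<bar>x\<bar> < \<bar>y\<bar>)" by auto
    moreover have "r < \<bar>x\<bar> \<Longrightarrow> y / x \<in> {-1..1} \<longleftrightarrow> \<bar>y\<bar> \<le> \<bar>x\<bar>"
      "r < \<bar>y\<bar> \<Longrightarrow> x / y \<in> {-1<..<1} \<longleftrightarrow> \<bar>x\<bar> < \<bar>y\<bar>"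
      using div assms by auto
    ultimately show ?thesis
      unfolding Q_swap indicator_def by auto
  qed
  have "emeasure \<nu> (sq R - sq r) = (\<integral>\<^sup>+x. \<integral>\<^sup>+y. ?A x y + ?B x y \<partial>lborel \<partial>lborel)"
    unfolding split[symmetric]
    by (subst emeasure_nu, simp, subst lborel_prod[symmetric], subst lborel.nn_integral_fst[symmetric])
       (auto simp: lborel_prod)
  also have "\<dots> = (\<integral>\<^sup>+x. \<integral>\<^sup>+y. ?A x y \<partial>lborel \<partial>lborel) + (\<integral>\<^sup>+x. \<integral>\<^sup>+y. ?B x y \<partial>lborel \<partial>lborel)"
    by (simp add: nn_integral_add)
  \<comment> \<open>After the exchange, \<open>y\<close> is the outer variable, as the sector lemma
    for the swapped form requires.\<close>
  also have "(\<integral>\<^sup>+x. \<integral>\<^sup>+y. ?B x y \<partial>lborel \<partial>lborel) = (\<integral>\<^sup>+y. \<integral>\<^sup>+x. ?B x y \<partial>lborel \<partial>lborel)"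
    by (rule lborel_pair.Fubini'[symmetric]) measurable
  also have "\<dots> = ?c * (\<integral>\<^sup>+t. ennreal (1 / sw.Q (1, t)) * indicator {-1<..<1} t \<partial>lborel)"
    using assms by (intro sw.nn_integral_sector) auto
  also have "(\<integral>\<^sup>+t. ennreal (1 / sw.Q (1, t)) * indicator {-1<..<1} t \<partial>lborel)
      = ennreal (2 / sqrt \<delta> * (arctan ((2 * a + b) / sqrt \<delta>) + arctan ((2 * a - b) / sqrt \<delta>)))"
    using sw.has_integral_edge
    by (intro nn_integral_has_integral_lebesgue')
       (auto simp: delta_swap sw.Q_nonneg has_integral_Icc_iff_Ioo)
  also have "(\<integral>\<^sup>+x. \<integral>\<^sup>+y. ?A x y \<partial>lborel \<partial>lborel) = ?c * (\<integral>\<^sup>+t. ennreal (1 / Q (1, t)) * indicator {-1..1} t \<partial>lborel)"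
    using assms by (intro nn_integral_sector) auto
  also have "(\<integral>\<^sup>+t. ennreal (1 / Q (1, t)) * indicator {-1..1} t \<partial>lborel)
      = ennreal (2 / sqrt \<delta> * (arctan ((2 * c + b) / sqrt \<delta>) + arctan ((2 * c - b) / sqrt \<delta>)))"
    using has_integral_edge by (intro nn_integral_has_integral_lebesgue') (auto simp: Q_nonneg)
  also have "?c * ennreal (2 / sqrt \<delta> * (arctan ((2 * c + b) / sqrt \<delta>) + arctan ((2 * c - b) / sqrt \<delta>)))
      + ?c * ennreal (2 / sqrt \<delta> * (arctan ((2 * a + b) / sqrt \<delta>) + arctan ((2 * a - b) / sqrt \<delta>)))
      = ?c * ennreal (2 / sqrt \<delta> * pi)"
    using has_integral_nonneg[OF has_integral_edge] has_integral_nonneg[OF sw.has_integral_edge]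
    unfolding edge_sum[symmetric] delta_swap distrib_left[of "2 / sqrt \<delta>" "_ + _" "_ + _"]
    by (subst ennreal_plus) (simp_all only: Q_nonneg sw.Q_nonneg distrib_left divide_nonneg_nonneg zero_le_one)
  also have "\<dots> = ennreal (2 * ln (R / r) * (2 / sqrt \<delta> * pi))"
    using assms delta_pos by (intro ennreal_mult[symmetric]) (auto simp: field_simps)
  finally show ?thesis by (simp add: mult_ac)
qed

end

section \<open>The midpoint rule on the corner square\<close>

text \<open>Here \<open>e\<close> and \<open>L\<close> stand for the even and odd parts of an
  increment of \<open>Q\<close>. Over the common denominator the terms linear in \<open>L\<close>
  cancel, and the numerator is \<open>2 * (L\<^sup>2 - e * (q + e))\<close>.\<close>

lemma abs_second_difference_inverse_le:
  fixes q e L m :: real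
  assumes "0 < m" "m \<le> q" "m \<le> q + e + L" "m \<le> q + e - L"
  shows "\<bar>1 / (q + e + L) + 1 / (q + e - L) - 2 / q\<bar> \<le> 2 * (L\<^sup>2 + \<bar>e\<bar> * (q + \<bar>e\<bar>)) / m ^ 3"
proof -
  have pos: "0 < q" "0 < q + e + L" "0 < q + e - L" using assms by auto
  let ?d = "q * (q + e + L) * (q + e - L)"
  have "1 / (q + e + L) + 1 / (q + e - L) - 2 / q = 2 * (L\<^sup>2 - e * (q + e)) / ?d"
    using pos by (simp add: divide_simps) (simp add: power2_eq_square algebra_simps)
  then have "\<bar>1 / (q + e + L) + 1 / (q + e - L) - 2 / q\<bar> = 2 * \<bar>L\<^sup>2 - e * (q + e)\<bar> / ?d"
    using pos by (simp only: abs_mult abs_divide) simp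
  also have "\<dots> \<le> 2 * (L\<^sup>2 + \<bar>e\<bar> * (q + \<bar>e\<bar>)) / m ^ 3"
  proof (rule frac_le)
    have "\<bar>L\<^sup>2 - e * (q + e)\<bar> \<le> L\<^sup>2 + \<bar>e\<bar> * \<bar>q + e\<bar>"
      using abs_triangle_ineq4[of "L\<^sup>2" "e * (q + e)"] by (simp add: abs_mult)
    also have "\<dots> \<le> L\<^sup>2 + \<bar>e\<bar> * (q + \<bar>e\<bar>)"
      using pos by (intro add_left_mono mult_left_mono) auto
    finally show "2 * \<bar>L\<^sup>2 - e * (q + e)\<bar> \<le> 2 * (L\<^sup>2 + \<bar>e\<bar> * (q + \<bar>e\<bar>))" by simp
    show "m ^ 3 \<le> ?d"
      unfolding power3_eq_cube using assms by (intro mult_mono) auto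
  qed (use assms in auto)
  finally show ?thesis .
qed

context posdef_form
begin

lemma Q_add: "Q (z + w) = Q z + Q w + (2 * a * fst z * fst w + b * (fst z * snd w + snd z * fst w) + 2 * c * snd z * snd w)"
  by (simp add: Q_def power2_eq_square algebra_simps)

text \<open>The even part \<open>Q w\<close> is of order \<open>h\<^sup>2\<close> and the odd part
  \<open>L\<close> of order \<open>h\<close>, so the preceding estimate is of order
  \<open>h\<^sup>2\<close>. The restriction \<open>h \<le> pi / 2\<close> keeps first coordinates at
  least \<open>pi / 2\<close>, which makes \<open>m\<close> a common lower bound for the
  denominators.\<close>

lemma second_difference_bound:
  obtains C where "\<And>h w. 0 < h \<Longrightarrow> h \<le> pi / 2 \<Longrightarrow> \<bar>fst w\<bar> \<le> h \<Longrightarrow> \<bar>snd w\<bar> \<le> h \<Longrightarrow>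
    \<bar>1 / Q ((pi, -pi) + w) + 1 / Q ((pi, -pi) - w) - 2 / Q (pi, -pi)\<bar> \<le> C * h\<^sup>2"
proof -
  define P :: "real \<times> real" where "P = (pi, -pi)"
  define M where "M = a + \<bar>b\<bar> + c"
  define m where "m = \<delta> * (pi / 2)\<^sup>2 / (4 * c)"
  \<comment> \<open>\<open>M\<close> controls both \<open>Q w\<close> and \<open>L\<close>; in the
    last factor \<open>h\<close> is replaced by its largest value \<open>pi / 2\<close>, so that a
    single \<open>h\<^sup>2\<close> can be taken out.\<close>
  define C where "C = 2 * ((2 * pi * M)\<^sup>2 + M * (Q P + M * (pi / 2)\<^sup>2)) / m ^ 3"
  have M: "M \<ge> 0" using a_pos c_pos by (simp add: M_def)
  have m: "m > 0" using delta_pos c_pos by (simp add: m_def)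
  have Q_ge_m: "m \<le> Q z" if "pi / 2 \<le> fst z" for z
  proof -
    have "m \<le> \<delta> * (fst z)\<^sup>2 / (4 * c)"
      unfolding m_def using that delta_pos c_pos
      by (intro divide_right_mono mult_left_mono power_mono) auto
    then show ?thesis using Q_ge[of z] by linarith
  qed
  have bound: "\<bar>1 / Q (P + w) + 1 / Q (P - w) - 2 / Q P\<bar> \<le> C * h\<^sup>2"
    if h: "0 < h" "h \<le> pi / 2" and w: "\<bar>fst w\<bar> \<le> h" "\<bar>snd w\<bar> \<le> h" for h w
  proof -
    define L where "L = 2 * a * pi * fst w + b * (pi * snd w - pi * fst w) - 2 * c * pi * snd w"
    have plus: "Q (P + w) = Q P + Q w + L" and minus: "Q (P - w) = Q P + Q w - L"
      using Q_add[of P w] Q_add[of P "- w"] by (simp_all add: L_def P_def algebra_simps)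
    have mono: "\<bar>fst w * fst w\<bar> \<le> h\<^sup>2" "\<bar>fst w * snd w\<bar> \<le> h\<^sup>2" "\<bar>snd w * snd w\<bar> \<le> h\<^sup>2"
      unfolding abs_mult power2_eq_square using w h by (simp_all only: mult_mono abs_ge_zero less_imp_le)
    have Qw: "\<bar>Q w\<bar> \<le> M * h\<^sup>2"
    proof -
      have "\<bar>Q w\<bar> \<le> \<bar>a * (fst w * fst w)\<bar> + \<bar>b * (fst w * snd w)\<bar> + \<bar>c * (snd w * snd w)\<bar>"
        unfolding Q_def power2_eq_square mult.assoc by linarith
      also have "\<dots> \<le> a * h\<^sup>2 + \<bar>b\<bar> * h\<^sup>2 + c * h\<^sup>2"
        using mono a_pos c_pos unfolding abs_mult[of a] abs_mult[of b] abs_mult[of c]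
        by (intro add_mono mult_mono) auto
      finally show ?thesis by (simp add: M_def algebra_simps)
    qed
    have L_le: "\<bar>L\<bar> \<le> 2 * pi * M * h"
    proof -
      have "\<bar>L\<bar> \<le> \<bar>(2 * a * pi) * fst w\<bar> + \<bar>(b * pi) * (snd w - fst w)\<bar> + \<bar>(2 * c * pi) * snd w\<bar>"
        unfolding L_def by (simp add: algebra_simps)
      also have "\<dots> \<le> (2 * a * pi) * h + (\<bar>b\<bar> * pi) * (2 * h) + (2 * c * pi) * h"
        unfolding abs_mult[of _ "fst w"] abs_mult[of _ "snd w"] abs_mult[of _ "snd w - fst w"]
        using w h a_pos c_pos by (intro add_mono mult_mono) (auto simp: abs_mult)
      finally show ?thesis by (simp add: M_def algebra_simps)
    qed
    have P: "pi / 2 \<le> fst P" "pi / 2 \<le> fst (P + w)" "pi / 2 \<le> fst (P - w)"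
      using h w pi_gt_zero by (auto simp: P_def)
    have "\<bar>1 / Q (P + w) + 1 / Q (P - w) - 2 / Q P\<bar>
        \<le> 2 * (L\<^sup>2 + \<bar>Q w\<bar> * (Q P + \<bar>Q w\<bar>)) / m ^ 3"
      unfolding plus minus using m Q_ge_m[OF P(1)] Q_ge_m[OF P(2)] Q_ge_m[OF P(3)]
      unfolding plus minus by (rule abs_second_difference_inverse_le)
    also have "\<dots> \<le> 2 * ((2 * pi * M * h)\<^sup>2 + (M * h\<^sup>2) * (Q P + M * (pi / 2)\<^sup>2)) / m ^ 3"
    proof (intro divide_right_mono mult_left_mono add_mono)
      show "L\<^sup>2 \<le> (2 * pi * M * h)\<^sup>2"
        using L_le by (rule power2_le_iff_abs_le[THEN iffD2, rotated]) (use M h in auto)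
      have "M * h\<^sup>2 \<le> M * (pi / 2)\<^sup>2"
        using h M by (intro mult_left_mono power_mono) auto
      with Qw have "Q P + \<bar>Q w\<bar> \<le> Q P + M * (pi / 2)\<^sup>2" by linarith
      then show "\<bar>Q w\<bar> * (Q P + \<bar>Q w\<bar>) \<le> (M * h\<^sup>2) * (Q P + M * (pi / 2)\<^sup>2)"
        using Qw M Q_nonneg[of P] by (intro mult_mono) auto
    qed (use m in auto)
    also have "\<dots> = C * h\<^sup>2"
      by (simp add: C_def power_mult_distrib algebra_simps add_divide_distrib)
    finally show ?thesis .
  qed
  show ?thesis
    by (rule that, fold P_def) (rule bound)
qed

text \<open>The reflection at the centre \<open>(pi, -pi)\<close> cancels the linear term.\<close>

lemma measure_corner:
  obtains C where "0 \<le> C" "\<And>h. 0 < h \<Longrightarrow> h \<le> pi / 2 \<Longrightarrow>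
    \<bar>measure \<nu> ({pi - h<..pi + h} \<times> {-pi - h..<-pi + h}) - 4 * h\<^sup>2 / Q (pi, -pi)\<bar> \<le> C * h ^ 4"
proof -
  define P :: "real \<times> real" where "P = (pi, -pi)"
  obtain C where C: "\<And>h w. 0 < h \<Longrightarrow> h \<le> pi / 2 \<Longrightarrow> \<bar>fst w\<bar> \<le> h \<Longrightarrow> \<bar>snd w\<bar> \<le> h \<Longrightarrow>
    \<bar>1 / Q (P + w) + 1 / Q (P - w) - 2 / Q P\<bar> \<le> C * h\<^sup>2"
    unfolding P_def using second_difference_bound by blast
  \<comment> \<open>The instance \<open>w = 0\<close> bounds an absolute value by
    \<open>C * (pi / 2)\<^sup>2\<close>.\<close>
  have C_nonneg: "0 \<le> C"
    using order_trans[OF abs_ge_zero C[of "pi / 2" 0]] by (simp add: zero_le_mult_iff)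
  have est: "\<bar>measure \<nu> ({pi - h<..pi + h} \<times> {-pi - h..<-pi + h}) - 4 * h\<^sup>2 / Q P\<bar> \<le> 2 * C * h ^ 4"
    if h: "0 < h" "h \<le> pi / 2" for h
  proof -
    let ?K = "{pi - h<..pi + h} \<times> {-pi - h..<-pi + h}"
    define B where "B = cbox (-(h, h)) (h, h)"
    define i where "i = integral (cbox (P - (h, h)) (P + (h, h))) (\<lambda>z. 1 / Q z)"
    have "Q z \<noteq> 0" if "z \<in> cbox (P - (h, h)) (P + (h, h))" for z
      using that h pi_gt_zero Q_pos[of z]
      by (cases z) (auto simp: P_def cbox_Pair_eq zero_prod_def)
    then have int: "((\<lambda>z. 1 / Q z) has_integral i) (cbox (P - (h, h)) (P + (h, h)))"
      unfolding i_def by (intro integrable_integral integrable_continuous continuous_intros) auto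
    have plus: "((\<lambda>w. 1 / Q (P + w)) has_integral i) B"
      using has_integral_affinity'[OF int, of 1 P] by (simp add: B_def add.commute uminus_prod_def)
    then have minus: "((\<lambda>w. 1 / Q (P - w)) has_integral i) B"
      using has_integral_reflect[of "\<lambda>w. 1 / Q (P + w)" i "(h, h)" "-(h, h)"] by (simp add: B_def)
    have content: "measure lborel B = 4 * h\<^sup>2"
      using h by (simp add: B_def content_Pair power2_eq_square)
    \<comment> \<open>\<open>B\<close> is symmetric, so both translates integrate to
      \<open>i\<close>; the second difference thus integrates to twice the midpoint error.\<close>
    have "((\<lambda>w. 1 / Q (P + w) + 1 / Q (P - w) - 2 / Q P) has_integral (i + i - measure lborel B *\<^sub>R (2 / Q P))) B"
      using plus minus unfolding B_def by (intro has_integral_diff has_integral_add has_integral_const)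
    then have bound: "norm (i + i - measure lborel B *\<^sub>R (2 / Q P)) \<le> C * h\<^sup>2 * measure lborel B"
      unfolding B_def
    proof (rule has_integral_bound[rotated])
      fix w assume "w \<in> cbox (-(h, h)) (h, h)"
      then have "\<bar>fst w\<bar> \<le> h" "\<bar>snd w\<bar> \<le> h"
        by (cases w; auto simp: cbox_Pair_eq)+
      then show "norm (1 / Q (P + w) + 1 / Q (P - w) - 2 / Q P) \<le> C * h\<^sup>2"
        using C[OF h] by simp
    qed (use C_nonneg in simp)
    have i: "\<bar>i - 4 * h\<^sup>2 / Q P\<bar> \<le> 2 * C * h ^ 4"
    proof -
      have "i + i - 4 * h\<^sup>2 * (2 / Q P) = 2 * (i - 4 * h\<^sup>2 / Q P)"
        by simp
      moreover have "C * h\<^sup>2 * (4 * h\<^sup>2) = 2 * (2 * C * h ^ 4)"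
        by (simp add: power2_eq_square power4_eq_xxxx)
      ultimately show ?thesis
        using bound unfolding content real_scaleR_def by (simp only: real_norm_def abs_mult) simp
    qed
    have K_box: "box (P - (h, h)) (P + (h, h)) \<subseteq> ?K" "?K \<subseteq> cbox (P - (h, h)) (P + (h, h))"
      by (auto simp: P_def box_def Basis_prod_def cbox_Pair_eq)
    have K [measurable]: "?K \<in> sets borel"
      by (intro borel_Times) auto
    \<comment> \<open>The half-open square and the closed box differ only inside the frontier, a
      null set.\<close>
    have "((\<lambda>z. 1 / Q z) has_integral i) ?K"
      using int
    proof (rule has_integral_spike_set_eq[THEN iffD1, rotated 2])
      show "negligible {x \<in> cbox (P - (h, h)) (P + (h, h)) - ?K. 1 / Q x \<noteq> 0}"
        by (rule negligible_subset[OF negligible_frontier_interval]) (use K_box in auto)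
      show "negligible {x \<in> ?K - cbox (P - (h, h)) (P + (h, h)). 1 / Q x \<noteq> 0}"
        using K_box by (auto intro: negligible_subset[OF negligible_empty])
    qed
    then have "emeasure \<nu> ?K = ennreal i"
      unfolding emeasure_nu[OF K] by (intro nn_integral_has_integral_lebesgue') (simp_all add: Q_nonneg)
    moreover have "0 \<le> i"
      using has_integral_nonneg[OF int] by (simp add: Q_nonneg)
    ultimately have "measure \<nu> ?K = i"
      by (simp add: measure_def)
    with i show ?thesis by simp
  qed
  show ?thesis
    by (rule that[of "2 * C"], use C_nonneg in simp, fold P_def) (rule est)
qed

section \<open>The shifted square and its mirror image\<close>

lemma fmeasurable_sq_diff:
  assumes "0 < r"
  shows "sq R - sq r \<in> fmeasurable \<nu>"
proof (cases "r \<le> R")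
  case True
  then show ?thesis
    using emeasure_sq_diff[OF assms True] by (intro fmeasurableI) (auto intro: sets.Diff)
next
  case False
  then have "sq R - sq r = {}" by (auto simp: sq_def)
  then show ?thesis by (simp only: fmeasurable.empty_sets)
qed

lemma measure_sq_diff:
  assumes "0 < r" "r \<le> R"
  shows "measure \<nu> (sq R - sq r) = 4 * pi / sqrt \<delta> * ln (R / r)"
  using emeasure_sq_diff[OF assms] assms delta_pos by (simp add: measure_def)

text \<open>The shifted square \<open>A\<close> and its mirror image \<open>-A\<close> intersect in the smaller centred square, and
  their union is the larger centred square without two opposite corners.\<close>

lemma measure_shifted_sq_diff:
  assumes h: "0 < h" "h \<le> p - h"
  shows "measure \<nu> ({-p - h..p - h} \<times> {-p - h..p - h} - sq h)
    = 2 * pi / sqrt \<delta> * (ln ((p + h) / h) + ln ((p - h) / h))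
      - measure \<nu> ({p - h<..p + h} \<times> {-p - h..<-p + h})"
proof -
  define A where "A = {-p - h..p - h} \<times> {-p - h..p - h}"
  \<comment> \<open>The two excluded sides already lie in \<open>A\<close> or in its mirror image,
    so the decomposition below is exactly disjoint.\<close>
  define K where "K = {p - h<..p + h} \<times> {-p - h..<-p + h}"
  have mirror: "uminus ` S = uminus -` S" for S :: "(real \<times> real) set"
    by (force simp: image_iff)
  have mem: "z \<in> uminus ` S \<longleftrightarrow> - z \<in> S" for z and S :: "(real \<times> real) set"
    by (simp add: mirror)
  have sets [measurable]: "A \<in> sets borel" "K \<in> sets borel"
    unfolding A_def K_def by (intro borel_Times; simp)+
  have sets' [measurable]: "uminus ` A \<in> sets borel" "uminus ` K \<in> sets borel"
    unfolding mirror by (rule measurable_sets_borel[of uminus borel]; simp add: sets)+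
  \<comment> \<open>Everything lies in one annulus of finite measure, which legitimates the
    real-valued inclusion-exclusion below.\<close>
  have fm: "S \<in> fmeasurable \<nu>" if "S \<subseteq> sq (p + h) - sq h" "S \<in> sets borel" for S
    using that by (auto intro: fmeasurableI2[OF fmeasurable_sq_diff[OF h(1), of "p + h"]])
  have mA: "measure \<nu> (uminus ` A - sq h) = measure \<nu> (A - sq h)"
  proof -
    have "uminus ` A - sq h = uminus ` (A - sq h)"
      by (auto simp: mem sq_def set_eq_iff)
    then show ?thesis by (simp add: measure_def emeasure_nu_uminus)
  qed
  have mK: "measure \<nu> (uminus ` K) = measure \<nu> K"
    by (simp add: measure_def emeasure_nu_uminus)
  have in_A: "A - sq h \<in> fmeasurable \<nu>" "uminus ` A - sq h \<in> fmeasurable \<nu>"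
  proof -
    have sub: "A - sq h \<subseteq> sq (p + h) - sq h" "uminus ` A - sq h \<subseteq> sq (p + h) - sq h"
      using h by (auto simp: mem A_def sq_def)
    show "A - sq h \<in> fmeasurable \<nu>" "uminus ` A - sq h \<in> fmeasurable \<nu>"
      using fm[OF sub(1)] fm[OF sub(2)] sets sets' by (auto intro: sets.Diff)
  qed
  have in_K: "K \<in> fmeasurable \<nu>" "uminus ` K \<in> fmeasurable \<nu>"
  proof -
    \<comment> \<open>First coordinates in \<open>K\<close> exceed \<open>p - h\<close>, which is at
      least \<open>h\<close>, so \<open>K\<close> misses the removed square.\<close>
    have sub: "K \<subseteq> sq (p + h) - sq h" "uminus ` K \<subseteq> sq (p + h) - sq h"
      using h by (auto simp: mem K_def sq_def)
    show "K \<in> fmeasurable \<nu>" "uminus ` K \<in> fmeasurable \<nu>"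
      using fm[OF sub(1)] fm[OF sub(2)] sets sets' by auto
  qed
  let ?U = "(A - sq h) \<union> (uminus ` A - sq h)"
  have inter: "(A - sq h) \<inter> (uminus ` A - sq h) = sq (p - h) - sq h"
    using h by (auto simp: mem A_def sq_def)
  have union: "sq (p + h) - sq h = ?U \<union> (K \<union> uminus ` K)"
    using h by (auto simp: mem A_def K_def sq_def)
  have disj: "?U \<inter> (K \<union> uminus ` K) = {}" "K \<inter> uminus ` K = {}"
    using h by (auto simp: mem A_def K_def sq_def)
  have "measure \<nu> (sq (p + h) - sq h) = measure \<nu> ?U + measure \<nu> (K \<union> uminus ` K)"
    unfolding union using measure_Un3[of ?U \<nu> "K \<union> uminus ` K"] in_A in_K disj
    by (simp add: fmeasurable.Un)
  moreover have "measure \<nu> (K \<union> uminus ` K) = 2 * measure \<nu> K"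
    using measure_Un3[OF in_K] disj mK by simp
  moreover have "measure \<nu> ?U = 2 * measure \<nu> (A - sq h) - measure \<nu> (sq (p - h) - sq h)"
    using measure_Un3[OF in_A] inter mA by simp
  ultimately have "2 * measure \<nu> (A - sq h)
      = measure \<nu> (sq (p + h) - sq h) + measure \<nu> (sq (p - h) - sq h) - 2 * measure \<nu> K"
    by linarith
  also have "\<dots> = 4 * pi / sqrt \<delta> * (ln ((p + h) / h) + ln ((p - h) / h)) - 2 * measure \<nu> K"
    using h by (simp add: measure_sq_diff distrib_left)
  finally show ?thesis by (simp add: A_def K_def)
qed

lemma measure_even_domain:
  obtains C where "\<And>n. (2::nat) \<le> n \<Longrightarrow>
    \<bar>measure \<nu> ({-pi - pi / real n..pi - pi / real n} \<times> {-pi - pi / real n..pi - pi / real n} - sq (pi / real n))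
      - (4 * pi / sqrt \<delta> * ln (real n) - (2 * pi / sqrt \<delta> + 4 / (a - b + c)) / (real n)\<^sup>2)\<bar> \<le> C / real n ^ 4"
proof -
  obtain C where C: "0 \<le> C" "\<And>h. 0 < h \<Longrightarrow> h \<le> pi / 2 \<Longrightarrow>
    \<bar>measure \<nu> ({pi - h<..pi + h} \<times> {-pi - h..<-pi + h}) - 4 * h\<^sup>2 / Q (pi, -pi)\<bar> \<le> C * h ^ 4"
    using measure_corner by blast
  have "\<bar>measure \<nu> ({-pi - pi / real n..pi - pi / real n} \<times> {-pi - pi / real n..pi - pi / real n} - sq (pi / real n))
      - (4 * pi / sqrt \<delta> * ln (real n) - (2 * pi / sqrt \<delta> + 4 / (a - b + c)) / (real n)\<^sup>2)\<bar>
      \<le> (4 * pi / sqrt \<delta> + C * pi ^ 4) / real n ^ 4"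
    if n: "2 \<le> n" for n :: nat
  proof -
    define h where "h = pi / real n"
    have n0: "real n \<ge> 2" using n by simp
    have h: "0 < h" "h \<le> pi / 2"
      using n0 by (auto simp: h_def simp: field_simps)
    \<comment> \<open>The remainder of the logarithm after its linear term; that term yields the
      contribution \<open>2 * pi / sqrt \<delta>\<close> to the coefficient of
      \<open>1 / n\<^sup>2\<close>.\<close>
    define e where "e = ln (1 + (- 1 / (real n)\<^sup>2)) - (- 1 / (real n)\<^sup>2)"
    have "4 \<le> (real n)\<^sup>2"
      using power_mono[OF n0, of 2] by simp
    then have "\<bar>e\<bar> \<le> 2 * (- 1 / (real n)\<^sup>2)\<^sup>2"
      unfolding e_def by (intro abs_ln_one_plus_x_minus_x_bound_nonpos) (auto simp: divide_le_eq)
    then have e: "\<bar>e\<bar> \<le> 2 / real n ^ 4"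
      by (simp add: power_divide flip: power_mult)
    define k where "k = measure \<nu> ({pi - h<..pi + h} \<times> {-pi - h..<-pi + h}) - 4 / (a - b + c) / (real n)\<^sup>2"
    have QP: "Q (pi, -pi) = pi\<^sup>2 * (a - b + c)"
      by (simp add: Q_def power2_eq_square algebra_simps)
    have "4 * h\<^sup>2 / Q (pi, -pi) = 4 / (a - b + c) / (real n)\<^sup>2"
      unfolding QP h_def by (simp add: power_divide)
    then have k: "\<bar>k\<bar> \<le> C * pi ^ 4 / real n ^ 4"
      using C(2)[OF h] unfolding k_def by (simp add: h_def power_divide)
    have "(pi + h) / h = real n + 1" "(pi - h) / h = real n - 1"
      using n0 by (auto simp: h_def field_simps)
    then have "ln ((pi + h) / h) + ln ((pi - h) / h) = ln ((real n + 1) * (real n - 1))"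
      using n0 by (simp add: ln_mult_pos)
    also have "(real n + 1) * (real n - 1) = (real n)\<^sup>2 * (1 + (- 1 / (real n)\<^sup>2))"
      using n0 by (simp add: power2_eq_square algebra_simps)
    also have "ln ((real n)\<^sup>2 * (1 + (- 1 / (real n)\<^sup>2))) = 2 * ln (real n) + (e - 1 / (real n)\<^sup>2)"
      using n0 \<open>4 \<le> (real n)\<^sup>2\<close> by (subst ln_mult_pos) (auto simp: e_def ln_realpow field_simps)
    finally have "measure \<nu> ({-pi - h..pi - h} \<times> {-pi - h..pi - h} - sq h)
      = 2 * pi / sqrt \<delta> * (2 * ln (real n) + (e - 1 / (real n)\<^sup>2)) - (k + 4 / (a - b + c) / (real n)\<^sup>2)"
      using h by (subst measure_shifted_sq_diff) (auto simp: k_def)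
    then have "measure \<nu> ({-pi - h..pi - h} \<times> {-pi - h..pi - h} - sq h)
      - (4 * pi / sqrt \<delta> * ln (real n) - (2 * pi / sqrt \<delta> + 4 / (a - b + c)) / (real n)\<^sup>2)
      = 2 * pi / sqrt \<delta> * e - k"
      by (simp add: algebra_simps add_divide_distrib)
    moreover have "\<bar>2 * pi / sqrt \<delta> * e\<bar> \<le> 2 * pi / sqrt \<delta> * (2 / real n ^ 4)"
      unfolding abs_mult[of _ e] using e delta_pos by (intro mult_mono) auto
    moreover have "(4 * pi / sqrt \<delta> + C * pi ^ 4) / real n ^ 4
      = 2 * pi / sqrt \<delta> * (2 / real n ^ 4) + C * pi ^ 4 / real n ^ 4"
      by (simp add: add_divide_distrib)
    ultimately show ?thesis
      using k unfolding h_def by linarith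
  qed
  then show ?thesis by (rule that)
qed

end

section \<open>Lattice bases and the coefficients of the form\<close>

lemma module_int_scale: "module (int_scale :: int \<Rightarrow> 'v::real_vector \<Rightarrow> 'v)"
  by unfold_locales (simp_all add: int_scale_def algebra_simps)

lemma int_span_subset_span: "int_span S \<subseteq> span S"
  by (rule module.span_minimal[OF module_int_scale])
     (auto simp: span_base module.subspace_def[OF module_int_scale] int_scale_def
           intro: span_add span_scale span_zero)

text \<open>Independence over the integers does not by itself give real independence, as 1 and
  \<open>sqrt 2\<close> show. Full rank makes the pair span the whole space, and two spanning
  vectors in dimension 2 are independent.\<close>

lemma independent_int_basis_pair:
  fixes u v :: "'v::real_vector"
  assumes dim: "dim (UNIV :: 'v set) = 2"
    and "full_rank_lattice L" "is_int_basis {u, v} L"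
  shows "u \<noteq> v" "independent {u, v}"
proof -
  obtain B where B: "span B = UNIV" "int_span B = L"
    using assms(2) by (auto simp: full_rank_lattice_def)
  have "B \<subseteq> span {u, v}"
    using module.span_superset[OF module_int_scale, of B] int_span_subset_span[of "{u, v}"]
      B(2) assms(3) by (auto simp: is_int_basis_def)
  then have span: "span {u, v} = UNIV"
    using B(1) span_minimal[of B, OF _ subspace_span, of "{u, v}"] by auto
  \<comment> \<open>A maximal independent subset still spans, so it has two elements and must be the
    whole pair; this also rules out \<open>u = v\<close>.\<close>
  obtain B' where B': "B' \<subseteq> {u, v}" "independent B'" "{u, v} \<subseteq> span B'"
    using maximal_independent_subset by blast
  have "span B' = UNIV"
    using span_minimal[OF B'(3) subspace_span] span by auto
  then have card: "card B' = 2"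
    using dim_eq_card[of B' UNIV] B'(2) dim by simp
  then show "u \<noteq> v"
    using B'(1) card_mono[of "{u, v}" B'] by (cases "u = v") auto
  then have "B' = {u, v}"
    using card B'(1) by (intro card_subset_eq) auto
  with B'(2) show "independent {u, v}" by simp
qed

lemma independent_pair_coords_eq:
  fixes u v :: "'v::real_vector"
  assumes "u \<noteq> v" "independent {u, v}" "x *\<^sub>R u + y *\<^sub>R v = x' *\<^sub>R u + y' *\<^sub>R v"
  shows "x = x'" "y = y'"
proof -
  have "(\<Sum>w\<in>{u, v}. (if w = u then x - x' else y - y') *\<^sub>R w) = 0"
    using assms(1,3) by (simp add: algebra_simps)
  from independentD[OF assms(2) _ subset_refl this]
  have "(if w = u then x - x' else y - y') = 0" if "w \<in> {u, v}" for w
    using that by simp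
  from this[of u] this[of v] assms(1) show "x = x'" "y = y'" by auto
qed

lemma sum_form_eq:
  fixes s :: "nat \<Rightarrow> int \<times> int"
  shows "(\<Sum>l=1..N. (real_of_int (fst (s l)) * x + real_of_int (snd (s l)) * y)\<^sup>2)
    = real_of_int (coeff_a N s) * x\<^sup>2 + real_of_int (coeff_b N s) * x * y + real_of_int (coeff_c N s) * y\<^sup>2"
  by (simp add: coeff_a_def coeff_b_def coeff_c_def power2_sum power_mult_distrib sum.distrib
      sum_distrib_left sum_distrib_right mult_ac)

text \<open>The summands for \<open>l = 1\<close> and \<open>l = 2\<close> alone contribute
  \<open>x\<^sup>2 + y\<^sup>2\<close>, so the form dominates the Euclidean one.\<close>

lemma posdef_form_coeffs:
  assumes "2 \<le> N" "s 1 = (1, 0)" "s 2 = (0, 1)"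
  shows "posdef_form (coeff_a N s) (coeff_b N s) (coeff_c N s)"
proof
  let ?F = "\<lambda>x y l. (real_of_int (fst (s l)) * x + real_of_int (snd (s l)) * y)\<^sup>2"
  let ?a = "real_of_int (coeff_a N s)" and ?b = "real_of_int (coeff_b N s)"
    and ?c = "real_of_int (coeff_c N s)"
  have ge: "x\<^sup>2 + y\<^sup>2 \<le> ?a * x\<^sup>2 + ?b * x * y + ?c * y\<^sup>2" for x y
  proof -
    have "x\<^sup>2 + y\<^sup>2 = (\<Sum>l\<in>{1, 2}. ?F x y l)"
      using assms(2,3) by simp
    also have "\<dots> \<le> (\<Sum>l=1..N. ?F x y l)"
      using assms(1) by (intro sum_mono2) auto
    finally show ?thesis by (simp only: sum_form_eq)
  qed
  show a: "0 < ?a"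
    using ge[of 1 0] by simp
  \<comment> \<open>At the vector \<open>(-b, 2 * a)\<close>, where the derivative in
    \<open>x\<close> vanishes, the form equals \<open>a * (4 * a * c - b\<^sup>2)\<close>.\<close>
  have "0 < (- ?b)\<^sup>2 + (2 * ?a)\<^sup>2"
    using a by (intro add_nonneg_pos) auto
  also note ge
  also have "?a * (- ?b)\<^sup>2 + ?b * (- ?b) * (2 * ?a) + ?c * (2 * ?a)\<^sup>2 = ?a * (4 * ?a * ?c - ?b\<^sup>2)"
    by (simp add: power2_eq_square algebra_simps)
  finally show "?b\<^sup>2 < 4 * ?a * ?c"
    using a by (simp add: zero_less_mult_iff)
qed

section \<open>The two formulas for \<open>I n (f1 N s)\<close>\<close>

theorem theorem5:
  fixes bv :: "nat \<Rightarrow> 'v::real_vector"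
    and N :: nat
    and s :: "nat \<Rightarrow> int \<times> int"
  assumes "dim (UNIV :: 'v set) = 2"
    and "2 \<le> N"
    and "\<And>l. l \<in> {1..N} \<Longrightarrow> bv l \<noteq> 0"
    and "full_rank_lattice (int_span (bv ` {1..N}))"
    and "is_int_basis {bv 1, bv 2} (int_span (bv ` {1..N}))"
    and "\<And>l. l \<in> {1..N} \<Longrightarrow>
      bv l = real_of_int (fst (s l)) *\<^sub>R bv 1 + real_of_int (snd (s l)) *\<^sub>R bv 2"
  shows
    "(\<forall>n. odd n \<longrightarrow>
        I n (f1 N s) =
          2 * real N / (pi * sqrt \<bar>real_of_int (discr N s)\<bar>) * (real n)\<^sup>2 * ln (real n))
     \<and>
     (\<lambda>n. I n (f1 N s) -
        (2 * real N / (pi * sqrt \<bar>real_of_int (discr N s)\<bar>) * (real n)\<^sup>2 * ln (real n)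
         - (real N / (pi * sqrt \<bar>real_of_int (discr N s)\<bar>)
            + 2 * real N / pi\<^sup>2 *
              (1 / real_of_int (coeff_a N s - coeff_b N s + coeff_c N s)))))
       \<in> O[inf sequentially (principal {n. even n})](\<lambda>n. 1 / (real n)\<^sup>2)"
proof -
  have basis: "bv 1 \<noteq> bv 2" "independent {bv 1, bv 2}"
    using independent_int_basis_pair[OF assms(1,4,5)] by auto
  \<comment> \<open>Uniqueness of real coordinates in the basis forces these values.\<close>
  have "s 1 = (1, 0)" "s 2 = (0, 1)"
    using assms(2) assms(6)[of 1] assms(6)[of 2]
      independent_pair_coords_eq[OF basis, of 1 0 "fst (s 1)" "snd (s 1)"]
      independent_pair_coords_eq[OF basis, of 0 1 "fst (s 2)" "snd (s 2)"]
    by (auto simp: prod_eq_iff)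
  with assms(2) interpret posdef_form "coeff_a N s" "coeff_b N s" "coeff_c N s"
    by (intro posdef_form_coeffs) auto
  let ?r = "sqrt \<bar>real_of_int (discr N s)\<bar>"
    and ?e = "real_of_int (coeff_a N s - coeff_b N s + coeff_c N s)"
  have discr: "?r = sqrt \<delta>"
    using delta_pos by (simp add: \<delta>_def discr_def)
  have r: "0 < ?r"
    unfolding discr using delta_pos by simp
  have f1: "f1 N s z = 2 * real N * (1 / Q z)" for z
    unfolding f1_def p1_def sum_form_eq Q_def by simp
  have D_eq: "D n = (if odd n then sq pi
      else {-pi - pi / real n..pi - pi / real n} \<times> {-pi - pi / real n..pi - pi / real n}) - sq (pi / real n)" for n
    by (simp add: D_def sq_def)
  have D_sets: "D n \<in> sets borel" for n
    unfolding D_eq by (intro sets.Diff sq_sets) (auto intro!: borel_closed closed_Times)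
  have I_eq: "I n (f1 N s) = (real n)\<^sup>2 / (4 * pi\<^sup>2) * (2 * real N * measure \<nu> (D n))" for n
    unfolding I_def f1 measure_nu[OF D_sets] set_integral_mult_right
    by (simp add: mesh_def power_divide power_mult_distrib)
  have "I n (f1 N s) = 2 * real N / (pi * ?r) * (real n)\<^sup>2 * ln (real n)" if "odd n" for n
  proof -
    have n: "0 < n" using that by (rule odd_pos)
    then have "measure \<nu> (D n) = 4 * pi / ?r * ln n"
      using that by (simp add: D_eq discr measure_sq_diff divide_le_eq)
    then show ?thesis
      unfolding I_eq using r by (simp add: field_simps power2_eq_square)
  qed
  moreover
  obtain C where C: "\<And>n. (2::nat) \<le> n \<Longrightarrow>
    \<bar>measure \<nu> ({-pi - pi / real n..pi - pi / real n} \<times> {-pi - pi / real n..pi - pi / real n} - sq (pi / real n))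
      - (4 * pi / sqrt \<delta> * ln (real n) - (2 * pi / sqrt \<delta> + 4 / (real_of_int (coeff_a N s) - real_of_int (coeff_b N s) + real_of_int (coeff_c N s))) / (real n)\<^sup>2)\<bar>
      \<le> C / real n ^ 4"
    by (rule measure_even_domain) (rule that)
  have "\<bar>I n (f1 N s) - (2 * real N / (pi * ?r) * (real n)\<^sup>2 * ln (real n)
      - (real N / (pi * ?r) + 2 * real N / pi\<^sup>2 * (1 / ?e)))\<bar>
      \<le> real N / (2 * pi\<^sup>2) * C * \<bar>1 / (real n)\<^sup>2\<bar>" if n: "2 \<le> n" "even n" for n
  proof -
    define X where "X = 4 * pi / ?r * ln n - (2 * pi / ?r + 4 / ?e) / (real n)\<^sup>2"
    have err: "\<bar>measure \<nu> (D n) - X\<bar> \<le> C / real n ^ 4"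
      using C[OF n(1)] n(2) by (simp add: D_eq X_def discr)
    have e: "0 < ?e"
      using Q_pos[of "(1, -1)"] by (simp add: Q_def zero_prod_def)
    have X: "(real n)\<^sup>2 / (4 * pi\<^sup>2) * (2 * real N * X) = 2 * real N / (pi * ?r) * (real n)\<^sup>2 * ln (real n)
      - (real N / (pi * ?r) + 2 * real N / pi\<^sup>2 * (1 / ?e))"
      unfolding X_def using n(1) r e
      by (simp add: divide_simps del: of_int_add of_int_diff)
         (simp add: power2_eq_square algebra_simps del: of_int_add of_int_diff)
    \<comment> \<open>The prefactor of order \<open>n\<^sup>2\<close> turns the error of order
      \<open>1 / n ^ 4\<close> in the measure into one of order
      \<open>1 / n\<^sup>2\<close>.\<close>
    have "\<bar>I n (f1 N s) - (real n)\<^sup>2 / (4 * pi\<^sup>2) * (2 * real N * X)\<bar>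
        = real N / (2 * pi\<^sup>2) * (real n)\<^sup>2 * \<bar>measure \<nu> (D n) - X\<bar>"
      unfolding I_eq right_diff_distrib[symmetric] abs_mult by (simp add: mult_ac)
    also have "\<dots> \<le> real N / (2 * pi\<^sup>2) * (real n)\<^sup>2 * (C / real n ^ 4)"
      by (intro mult_left_mono err) simp
    also have "\<dots> = real N / (2 * pi\<^sup>2) * C * \<bar>1 / (real n)\<^sup>2\<bar>"
      using n(1) by (simp add: power2_eq_square power4_eq_xxxx)
    finally show ?thesis unfolding X .
  qed
  then have "(\<lambda>n. I n (f1 N s) - (2 * real N / (pi * ?r) * (real n)\<^sup>2 * ln (real n)
      - (real N / (pi * ?r) + 2 * real N / pi\<^sup>2 * (1 / ?e))))
      \<in> O[inf sequentially (principal {n. even n})](\<lambda>n. 1 / (real n)\<^sup>2)"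
    by (intro bigoI[where c = "real N / (2 * pi\<^sup>2) * C"])
       (auto simp only: eventually_inf_principal eventually_sequentially real_norm_def mem_Collect_eq)
  ultimately show ?thesis by blast
qed

end
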